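(* Let $p\ge 3$ be an integer. The James-Stein estimator $$\delta_{JS}(X)=\left(1-\frac{p-2}{\|X\|^2}\right)X$$ of the mean vector $\theta$ based on $X\sim N_p(\theta,I_p)$ is quasi-admissible.
   Context: $\|\cdot\|$ is the Euclidean norm on $\mathbb{R}^p$ and $\nabla=(\partial/\partial x_1,\dots,\partial/\partial x_p)'$. For a positive differentiable function $m$ on $(0,\infty)$, let $\delta_m$ be the estimator $\delta_m(x)=x+\nabla\log m(\|x\|^2)=\{1+2m'(\|x\|^2)/m(\|x\|^2)\}x$ (for $x\neq 0$). Competitors of $\delta_m$ are the estimators $\delta_{m,k}(x)=\delta_m(x)+k(\|x\|^2)x$ with $k:(0,\infty)\to\mathbb{R}$ differentiable. The difference of the unbiased risk estimators (under loss $\|\delta-\theta\|^2$) of $\delta_{m,k}$ and $\delta_m$ is, with $w=\|x\|^2$, $$\Delta(m,mk)(w)=4w\frac{m'(w)}{m(w)}k(w)+2p\,k(w)+4w\,k'(w)+w\,k(w)^2 .$$ An estimator of the form $\delta_m$ is called quasi-admissible if there exists no differentiable $k$ such that $\Delta(m,mk)(w)\le 0$ for all $w>0$ with strict inequality for some $w$. (Since $\Delta$ depends on $m$ only through $m'/m$, which is determined by $\delta_m$, this is a property of the estimator.) *)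

theory Defs
  imports "HOL-Analysis.Analysis"
begin

text \<open>Functions on \<open>(0,\<infinity>)\<close> are total functions on the reals of which only the values at
  positive arguments are ever used; likewise estimators are only considered at \<open>x \<noteq> 0\<close>.\<close>

definition delta_est :: "(real \<Rightarrow> real) \<Rightarrow> real ^ 'p \<Rightarrow> real ^ 'p" where
  "delta_est m x = (1 + 2 * deriv m ((norm x)\<^sup>2) / m ((norm x)\<^sup>2)) *\<^sub>R x"

text \<open>The difference \<open>\<Delta>(m, mk)(w)\<close> of the unbiased risk estimators, in dimension \<open>p\<close>, of the
  competitor \<open>x \<mapsto> delta_est m x + k (\<parallel>x\<parallel>\<^sup>2) x\<close> and of \<open>delta_est m\<close>, at \<open>w = \<parallel>x\<parallel>\<^sup>2\<close>.\<close>

definition risk_diff :: "nat \<Rightarrow> (real \<Rightarrow> real) \<Rightarrow> (real \<Rightarrow> real) \<Rightarrow> real \<Rightarrow> real" where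
  "risk_diff p m k w =
     4 * w * (deriv m w / m w) * k w + 2 * real p * k w + 4 * w * deriv k w + w * (k w)\<^sup>2"

text \<open>The function \<open>m\<close> representing an estimator is unique only up to a constant factor. Its
  choice does not matter, by the lemma \<open>risk_diff_cong\<close> below.\<close>

definition quasi_admissible :: "(real ^ 'p \<Rightarrow> real ^ 'p) \<Rightarrow> bool" where
  "quasi_admissible d \<longleftrightarrow>
     (\<exists>m. (\<forall>w>0. m w > 0) \<and> m differentiable_on {0<..} \<and>
          (\<forall>x. x \<noteq> 0 \<longrightarrow> d x = delta_est m x) \<and>
          \<not> (\<exists>k. k differentiable_on {0<..} \<and>
                 (\<forall>w>0. risk_diff CARD('p) m k w \<le> 0) \<and>
                 (\<exists>w>0. risk_diff CARD('p) m k w < 0)))"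

definition james_stein :: "real ^ 'p \<Rightarrow> real ^ 'p" where
  "james_stein x = (1 - (real CARD('p) - 2) / (norm x)\<^sup>2) *\<^sub>R x"

lemma delta_est_eq_gradient:
  fixes x :: "real ^ 'p"
  assumes pos: "\<And>w. w > 0 \<Longrightarrow> m w > 0" and diff: "m differentiable_on {0<..}" and "x \<noteq> 0"
  shows "GDERIV (\<lambda>y. ln (m ((norm y)\<^sup>2))) x :> delta_est m x - x"
proof -
  let ?w = "(norm x)\<^sup>2"
  have w: "?w > 0" using \<open>x \<noteq> 0\<close> by simp
  then have "m differentiable at ?w"
    using diff by (simp add: differentiable_on_eq_differentiable_at)
  then have m: "(m has_real_derivative deriv m ?w) (at ?w)"
    by (simp add: DERIV_deriv_iff_real_differentiable)
  have "((\<lambda>t. ln (m t)) has_real_derivative (1 / m ?w) * deriv m ?w) (at ?w)"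
    by (rule DERIV_chain2[OF DERIV_ln_divide[OF pos[OF w]] m])
  then have 1: "((\<lambda>t. ln (m t)) has_real_derivative deriv m ?w / m ?w) (at (x \<bullet> x))"
    by (simp add: power2_norm_eq_inner)
  have 2: "((\<lambda>y. y \<bullet> y) has_derivative (\<lambda>h. 2 * (x \<bullet> h))) (at x)"
    by (auto intro!: derivative_eq_intros simp: inner_commute)
  have "((\<lambda>y. ln (m (y \<bullet> y))) has_derivative (\<lambda>h. deriv m ?w / m ?w * (2 * (x \<bullet> h)))) (at x)"
    using has_derivative_compose[OF 2 1[unfolded has_field_derivative_def]] by simp
  then show ?thesis
    unfolding gderiv_def delta_est_def
    by (simp add: power2_norm_eq_inner scaleR_add_left inner_commute mult_ac)
qed

lemma risk_diff_cong:
  assumes eq: "\<And>x :: real ^ 'p. x \<noteq> 0 \<Longrightarrow> delta_est m x = delta_est n x" and "w > 0"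
  shows "risk_diff p m k w = risk_diff p n k w"
proof -
  obtain x :: "real ^ 'p" where x: "norm x = sqrt w"
    using vector_choose_size[of "sqrt w"] \<open>w > 0\<close> by auto
  then have "x \<noteq> 0" "(norm x)\<^sup>2 = w" using \<open>w > 0\<close> by auto
  with eq[of x] have "deriv m w / m w = deriv n w / n w"
    by (simp add: delta_est_def)
  then show ?thesis by (simp add: risk_diff_def)
qed

end

theory Submission
  imports Defs
begin

text \<open>The James--Stein estimator is \<open>delta_est m\<close> for \<open>m(w) = w powr (-(p - 2) / 2)\<close>, and then
  \<open>\<Delta>(w) = 4 k + 4 w k' + w k\<^sup>2\<close>. In terms of \<open>v(t) = e\<^sup>t k(e\<^sup>t)\<close> the condition \<open>\<Delta> \<le> 0\<close> becomes
  the Riccati inequality \<open>4 v' \<le> - v\<^sup>2\<close> on the whole real line. Its nonzero solutions blow up in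
  finite time (forwards if negative, backwards if positive), so \<open>k = 0\<close> and \<open>\<Delta> = 0\<close>.\<close>

text \<open>Since \<open>v\<close> is nonincreasing, a negative value persists to the right of
  \<open>a\<close>. There (1/v)' = - v'/v^2 \<ge> c, so the negative function 1/v grows at least
  linearly and would have to reach 0 in finite time.\<close>

lemma riccati_ineq_nonneg:
  fixes v v' :: "real \<Rightarrow> real"
  assumes der: "\<And>t. (v has_real_derivative v' t) (at t)"
    and ineq: "\<And>t. v' t \<le> - c * (v t)\<^sup>2" and "c > 0"
  shows "v a \<ge> 0"
proof (rule ccontr)
  assume "\<not> v a \<ge> 0"
  then have neg_a: "v a < 0" by simp
  have v'_le: "v' t \<le> 0" for t
    using ineq[of t] \<open>c > 0\<close> by (smt (verit) mult_minus_left mult_nonneg_nonneg zero_le_power2)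
  have neg: "v t < 0" if "t \<ge> a" for t
    using DERIV_nonpos_imp_nonincreasing[OF that, of v] der v'_le neg_a by (meson le_less_trans)
  \<comment> \<open>The time at which the lower bound 1/v(a) + c (t - a) for 1/v(t) reaches
    0.\<close>
  define b where "b = a - 1 / (c * v a)"
  have "a \<le> b"
    using mult_pos_neg[OF \<open>c > 0\<close> neg_a] by (simp add: b_def divide_le_0_iff)
  have "1 / v a - c * a \<le> 1 / v b - c * b"
  proof (rule DERIV_nonneg_imp_nondecreasing[OF \<open>a \<le> b\<close>])
    fix t assume "a \<le> t"
    then have nz: "v t \<noteq> 0" using neg[of t] by simp
    have "((\<lambda>t. 1 / v t - c * t) has_real_derivative - v' t / (v t)\<^sup>2 - c) (at t)"
      using der[of t] nz by (auto intro!: derivative_eq_intros simp: power2_eq_square)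
    moreover have "- v' t / (v t)\<^sup>2 - c \<ge> 0"
      using ineq[of t] nz by (simp add: field_simps)
    ultimately show "\<exists>y. ((\<lambda>t. 1 / v t - c * t) has_real_derivative y) (at t) \<and> 0 \<le> y"
      by blast
  qed
  moreover have "c * b = c * a - 1 / v a"
    using neg_a \<open>c > 0\<close> by (simp add: b_def field_simps)
  ultimately have "1 / v b \<ge> 0" by simp
  with neg[OF \<open>a \<le> b\<close>] show False by simp
qed

text \<open>The reflection sending v(t) to - v(-t) preserves the inequality, so the sign bound
  applies to both functions and forces v(a) = 0.\<close>

lemma riccati_ineq_zero:
  fixes v v' :: "real \<Rightarrow> real"
  assumes der: "\<And>t. (v has_real_derivative v' t) (at t)"
    and ineq: "\<And>t. v' t \<le> - c * (v t)\<^sup>2" and "c > 0"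
  shows "v a = 0"
proof -
  have "((\<lambda>t. - v (- t)) has_real_derivative v' (- t)) (at t)" for t
    by (auto intro!: derivative_eq_intros DERIV_chain2[OF der])
  then have "- v (- (- a)) \<ge> 0"
    using ineq \<open>c > 0\<close> by (intro riccati_ineq_nonneg[where v' = "\<lambda>t. v' (- t)" and c = c]) auto
  with riccati_ineq_nonneg[OF assms, of a] show ?thesis by simp
qed

lemma euler_riccati_ineq_zero:
  fixes k :: "real \<Rightarrow> real"
  assumes diff: "k differentiable_on {0<..}"
    and ineq: "\<And>w. w > 0 \<Longrightarrow> 4 * k w + 4 * w * deriv k w + w * (k w)\<^sup>2 \<le> 0"
    and "w > 0"
  shows "k w = 0"
proof -
  define v where "v t = exp t * k (exp t)" for t
  define v' where "v' t = exp t * k (exp t) + exp t * (deriv k (exp t) * exp t)" for t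
  have "(v has_real_derivative v' t) (at t)" for t
  proof -
    have "k differentiable at (exp t)"
      using diff by (simp add: differentiable_on_eq_differentiable_at)
    then have "(k has_real_derivative deriv k (exp t)) (at (exp t))"
      by (simp add: DERIV_deriv_iff_real_differentiable)
    from DERIV_chain2[OF this DERIV_exp] show ?thesis
      unfolding v_def v'_def by (auto intro!: derivative_eq_intros)
  qed
  moreover have "v' t \<le> - (1/4) * (v t)\<^sup>2" for t
  proof -
    \<comment> \<open>With w = exp t, the factor exp t turns the left-hand side into exactly 4 v' +
      v^2.\<close>
    have "exp t * (4 * k (exp t) + 4 * exp t * deriv k (exp t) + exp t * (k (exp t))\<^sup>2) \<le> 0"
      using ineq[of "exp t"] by (simp add: mult_le_0_iff)
    then show ?thesis
      by (simp add: v_def v'_def algebra_simps power2_eq_square)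
  qed
  ultimately have "v (ln w) = 0"
    by (rule riccati_ineq_zero) simp
  with \<open>w > 0\<close> show ?thesis by (simp add: v_def)
qed

theorem corollary2p1:
  assumes "CARD('p::finite) \<ge> 3"
  shows "quasi_admissible (james_stein :: real ^ 'p \<Rightarrow> real ^ 'p)"
proof -
  define p where "p = real CARD('p)"
  \<comment> \<open>The exponent solves 2 m'/m = - (p - 2)/w, which matches the shrinkage factor of
    \<open>james_stein\<close>.\<close>
  define m where "m w = w powr (- (p - 2) / 2)" for w :: real
  have pos: "m w > 0" if "w > 0" for w
    using that by (simp add: m_def)
  have der: "(m has_real_derivative - (p - 2) / (2 * w) * m w) (at w)" if "w > 0" for w
    using has_real_derivative_powr[OF that, of "- (p - 2) / 2"] that
    by (simp only: m_def[abs_def] powr_diff powr_one less_imp_le times_divide_eq_right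
        times_divide_eq_left divide_divide_eq_left)
  have ratio: "deriv m w / m w = - (p - 2) / (2 * w)" if "w > 0" for w
    using DERIV_imp_deriv[OF der[OF that]] pos[OF that] by simp
  \<comment> \<open>The m'/m term equals - 2 (p - 2) k, which reduces 2 p k to 4 k: the dimension
    cancels.\<close>
  have risk: "risk_diff CARD('p) m k w = 4 * k w + 4 * w * deriv k w + w * (k w)\<^sup>2"
    if "w > 0" for k w
    unfolding risk_diff_def ratio[OF that] using that
    by (simp add: field_simps p_def)
  show ?thesis
    unfolding quasi_admissible_def
  proof (intro exI[of _ m] conjI allI impI notI)
    show "m differentiable_on {0<..}"
      by (auto simp: differentiable_on_eq_differentiable_at real_differentiable_def intro: der)
    show "james_stein x = delta_est m x" if "x \<noteq> 0" for x :: "real ^ 'p"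
      using ratio[of "(norm x)\<^sup>2"] that
      by (simp add: james_stein_def delta_est_def p_def diff_divide_distrib
            flip: times_divide_eq_right)
  next
    assume "\<exists>k. k differentiable_on {0<..} \<and>
                 (\<forall>w>0. risk_diff CARD('p) m k w \<le> 0) \<and>
                 (\<exists>w>0. risk_diff CARD('p) m k w < 0)"
    then obtain k w where diff: "k differentiable_on {0<..}"
      and le: "\<And>w. w > 0 \<Longrightarrow> risk_diff CARD('p) m k w \<le> 0"
      and w: "w > 0" "risk_diff CARD('p) m k w < 0" by blast
    have zero: "k u = 0" if "u > 0" for u
      using diff le that by (intro euler_riccati_ineq_zero) (auto simp: risk)
    \<comment> \<open>\<open>k\<close> is known to vanish only on the positive half-line; as this
      set is open, the derivative at \<open>w\<close> is 0 too.\<close>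
    have "(k has_real_derivative 0) (at w)"
      by (rule has_field_derivative_transform_within_open[where f = "\<lambda>_. 0" and S = "{0<..}"])
        (use w zero in auto)
    then have "risk_diff CARD('p) m k w = 0"
      using w(1) zero by (simp add: risk DERIV_imp_deriv)
    with w(2) show False by simp
  qed (rule pos)
qed

end
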